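(* For $m\ge 1$ let $$R_m(x,y)=\sum_{n\ge 0}\ \sum_{k=0}^n\ \sum_{\substack{\pi\in\mathcal R_{n,k}\\ \mathcal F_\pi=m}}\frac{x^n}{n!}\,y^k$$ be the exponential generating function for the number of sequences in $\mathcal R_{n,k}$ with exactly $m$ fixed points. Then for all $m\ge 1$, $$R_m(x,y)=\frac{1}{(m-1)!}\int_0^x y^m t^{m-1}e^{y(e^{x-t}-1)+m(x-t)}\,dt-\frac{1}{m!}\int_0^x y^{m+1}t^m e^{y(e^{x-t}-1)+(m+1)(x-t)}\,dt .$$
   Context: A restricted growth sequence of length $n\ge 1$ is a sequence $\pi=\pi_1\pi_2\cdots\pi_n$ of positive integers with $\pi_1=1$ and $\pi_{j+1}\le 1+\max\{\pi_1,\dots,\pi_j\}$ for all $1\le j<n$. The set $\mathcal R_{n,k}$ consists of all restricted growth sequences of length $n$ with maximal letter $k$; $\mathcal R_{n,0}$ contributes nothing to $R_m$ for $m\ge 1$. An index $i\in\{1,\dots,n\}$ is a fixed point of $\pi$ if $\pi_i=i$, and $\mathcal F_\pi$ denotes the number of fixed points of $\pi$. Generating functions may be read as formal power series in $x$ with coefficients polynomial in $y$; the integrals are the corresponding formal integrals in $t$. *)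

theory Defs
  imports
    "HOL-Computational_Algebra.Polynomial"
    "HOL-Computational_Algebra.Formal_Power_Series"
begin

unbundle fps_syntax

text \<open>The letter $\pi_i$ of the mathematics (indexed from 1) is \<open>\<pi> ! (i - 1)\<close>.\<close>

definition rgs :: "nat list \<Rightarrow> bool" where
  "rgs \<pi> \<longleftrightarrow>
     \<pi> \<noteq> [] \<and> (\<forall>a\<in>set \<pi>. 0 < a) \<and> \<pi> ! 0 = 1 \<and>
     (\<forall>j. 1 \<le> j \<and> j < length \<pi> \<longrightarrow> \<pi> ! j \<le> 1 + Max (set (take j \<pi>)))"

definition RGS :: "nat \<Rightarrow> nat \<Rightarrow> nat list set" where
  "RGS n k = {\<pi>. rgs \<pi> \<and> length \<pi> = n \<and> Max (set \<pi>) = k}"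

definition fixed_points :: "nat list \<Rightarrow> nat" where
  "fixed_points \<pi> = card {i \<in> {1..length \<pi>}. \<pi> ! (i - 1) = i}"

lemma finite_RGS: "finite (RGS n k)"
proof (rule finite_subset)
  show "RGS n k \<subseteq> {\<pi>. set \<pi> \<subseteq> {..k} \<and> length \<pi> = n}"
    by (auto simp: RGS_def)
  show "finite {\<pi>. set \<pi> \<subseteq> {..k} \<and> length \<pi> = n}"
    by (rule finite_lists_length_eq) simp
qed

text \<open>Univariate series are power series in $x$ whose coefficients are polynomials in $y$.\<close>

definition R_egf :: "nat \<Rightarrow> rat poly fps" where
  "R_egf m = Abs_fps (\<lambda>n. \<Sum>k=0..n. \<Sum>\<pi> | \<pi> \<in> RGS n k \<and> fixed_points \<pi> = m.
     monom (1 / fact n) k)"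

text \<open>Series in $x$ and $t$ are power series in $t$ (outer) with coefficients
  power series in $x$ (inner): the coefficient of $x^j t^i$ in \<open>F\<close> is \<open>F $ i $ j\<close>.\<close>

type_synonym bifps = "rat poly fps fps"

definition var_t :: bifps where "var_t = fps_X"
definition var_x :: bifps where "var_x = fps_const fps_X"
definition var_y :: bifps where "var_y = fps_const (fps_const [:0, 1:])"

text \<open>$e^w = \sum_n w^n/n!$ for \<open>w\<close> without constant term. Then $w^n$ has no terms of total
  degree below $n$, so cutting the sum off at \<open>i + j\<close> loses nothing in the coefficient
  of $x^j t^i$ (lemma \<open>biexp_nth\<close> below).\<close>

definition biexp :: "bifps \<Rightarrow> bifps" where
  "biexp w = Abs_fps (\<lambda>i. Abs_fps (\<lambda>j. \<Sum>n\<le>i + j. smult (1 / fact n) ((w ^ n) $ i $ j)))"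

lemma bifps_power_nth_eq_0:
  fixes w :: bifps
  assumes "w $ 0 $ 0 = 0" "i + j < n"
  shows "(w ^ n) $ i $ j = 0"
  using assms(2)
proof (induction n arbitrary: i j)
  case 0
  then show ?case by simp
next
  case (Suc n)
  have "w $ a $ b * (w ^ n) $ (i - a) $ (j - b) = 0" if "a \<le> i" "b \<le> j" for a b
  proof (cases "a = 0 \<and> b = 0")
    case True
    then show ?thesis using assms(1) by simp
  next
    case False
    with that Suc.prems have "(i - a) + (j - b) < n" by auto
    then show ?thesis using Suc.IH by simp
  qed
  then show ?case
    by (simp add: fps_mult_nth fps_sum_nth del: mult_eq_0_iff)
qed

lemma biexp_nth:
  assumes "w $ 0 $ 0 = 0" "i + j \<le> N"
  shows "biexp w $ i $ j = (\<Sum>n\<le>N. smult (1 / fact n) ((w ^ n) $ i $ j))"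
  unfolding biexp_def fps_nth_Abs_fps
  by (rule sum.mono_neutral_left) (use assms in \<open>auto intro: bifps_power_nth_eq_0\<close>)

text \<open>The antiderivative with respect to $t$ that vanishes at $t = 0$.\<close>

definition antideriv_t :: "bifps \<Rightarrow> bifps" where
  "antideriv_t F =
     Abs_fps (\<lambda>i. if i = 0 then 0 else fps_const [:1 / of_nat i:] * F $ (i - 1))"

text \<open>The substitution $t := x$.\<close>

definition subst_t_x :: "bifps \<Rightarrow> rat poly fps" where
  "subst_t_x F = Abs_fps (\<lambda>n. \<Sum>i\<le>n. F $ i $ (n - i))"

text \<open>$\int_0^x F(x,t)\,dt$\<close>

definition integral_0_x :: "bifps \<Rightarrow> rat poly fps" where
  "integral_0_x F = subst_t_x (antideriv_t F)"

end

theory Submission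
  imports Defs
begin

text \<open>
  The $i$-th letter of a restricted growth sequence is at most $i$, and it equals $i$ only if the
  sequence starts with $1 2 \cdots i$. Hence the fixed points form an initial segment, and there
  are at least $m$ of them iff the sequence is $1 2 \cdots m$ followed by an admissible
  continuation (\<open>fixed_points_ge_iff_prefix\<close>). Exactly $m$ means at least $m$ but not at least
  $m+1$; this is the difference in the theorem, and its two terms have the same form.

  Let $w_m(r)$ enumerate by $y^{\max}$ the continuations of length $r$ of a prefix with maximum
  $m$. The next letter is one of the $m$ letters seen so far or the new letter $m+1$, so
  $w_m(r+1) = m\,w_m(r) + w_{m+1}(r)$. For $G_m(x) = \sum_r w_m(r)\,x^r/r!$ this says
  $G_m' = m\,G_m + G_{m+1}$ with $G_m(0) = y^m$, and it is solved by
  $G_m(x) = y^m e^{y(e^x-1)+mx}$ (\<open>exp_bell_exponent_nth\<close>).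

  A sequence with at least $m$ fixed points and length $m+r$ contributes with the weight
  $x^{m+r}/(m+r)!$ instead of $x^r/r!$. That shift is $m$-fold integration, which by the Beta
  integral is $\frac{1}{(m-1)!}\int_0^x t^{m-1} G_m(x-t)\,dt$
  (\<open>integral_0_x_subst_x_minus_t_nth\<close>).

  On the side of formal series, the substitution $z \mapsto x-t$ is a ring homomorphism from
  series in one variable to series in $x$ and $t$, and it commutes with the exponential. So the
  integrands are images of one-variable series, and the differential equations are only needed
  in one variable.
\<close>

section \<open>Restricted growth sequences read from left to right\<close>

text \<open>A word \<open>ws\<close> satisfies \<open>rgs_from M\<close> if it may follow a prefix whose maximum is \<open>M\<close>. Only the
  maximum of the prefix matters, which turns the growth condition into a recursion on the word;
  \<open>M = 0\<close> stands for the empty prefix and forces the first letter to be 1.\<close>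

fun rgs_from :: "nat \<Rightarrow> nat list \<Rightarrow> bool" where
  "rgs_from M [] \<longleftrightarrow> True"
| "rgs_from M (a # ws) \<longleftrightarrow> 0 < a \<and> a \<le> Suc M \<and> rgs_from (max M a) ws"

lemma rgs_from_append:
  "rgs_from M (us @ ws) \<longleftrightarrow> rgs_from M us \<and> rgs_from (fold max us M) ws"
  by (induction us arbitrary: M) (auto simp: max.commute)

lemma fold_max_eq_Max: "fold max ws M = Max (insert M (set ws))" for M :: "'a :: linorder"
  using Max.set_eq_fold[of M ws] by simp

lemma fold_max_0_eq_Max: "ws \<noteq> [] \<Longrightarrow> fold max ws (0::nat) = Max (set ws)"
  unfolding fold_max_eq_Max by (subst Max_insert) auto

lemma rgs_snoc:
  "rgs (us @ [a]) \<longleftrightarrow> (if us = [] then a = 1 else rgs us \<and> 0 < a \<and> a \<le> 1 + Max (set us))"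
proof (cases "us = []")
  case True
  then show ?thesis by (auto simp: rgs_def)
next
  case False
  then have "(us @ [a]) ! 0 = us ! 0" by (simp add: nth_append)
  moreover have "(\<forall>j. 1 \<le> j \<and> j < length (us @ [a]) \<longrightarrow>
        (us @ [a]) ! j \<le> 1 + Max (set (take j (us @ [a])))) \<longleftrightarrow>
      (\<forall>j. 1 \<le> j \<and> j < length us \<longrightarrow> us ! j \<le> 1 + Max (set (take j us))) \<and>
      a \<le> 1 + Max (set us)" (is "?l \<longleftrightarrow> ?r")
  proof
    assume l: ?l
    show ?r
    proof (intro conjI allI impI)
      fix j assume "1 \<le> j \<and> j < length us"
      with l[rule_format, of j] show "us ! j \<le> 1 + Max (set (take j us))"
        by (simp add: nth_append)
    next
      show "a \<le> 1 + Max (set us)"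
        using l[rule_format, of "length us"] False by (simp add: Suc_le_eq)
    qed
  next
    assume ?r
    then show ?l by (auto simp: nth_append less_Suc_eq)
  qed
  ultimately show ?thesis using False by (auto simp: rgs_def)
qed

lemma rgs_iff_rgs_from: "rgs \<pi> \<longleftrightarrow> \<pi> \<noteq> [] \<and> rgs_from 0 \<pi>"
proof (induction \<pi> rule: rev_induct)
  case Nil
  then show ?case by (simp add: rgs_def)
next
  case (snoc a us)
  then show ?case
    by (auto simp: rgs_snoc rgs_from_append fold_max_0_eq_Max)
qed

text \<open>Each letter raises the running maximum by at most one.\<close>

lemma rgs_from_nth_le:
  "rgs_from M ws \<Longrightarrow> i < length ws \<Longrightarrow> ws ! i \<le> M + i + 1"
proof (induction ws arbitrary: M i)
  case (Cons a ws)
  show ?case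
  proof (cases i)
    case (Suc i')
    with Cons have "ws ! i' \<le> max M a + i' + 1" by simp
    also have "\<dots> \<le> M + i + 1" using Cons.prems Suc by simp
    finally show ?thesis using Suc by simp
  qed (use Cons.prems in simp)
qed simp

text \<open>A letter that attains the bound of the previous lemma forces the running maximum to rise
  at every earlier position. For \<open>M = 0\<close>: all positions before a fixed point are fixed points.\<close>

lemma rgs_from_nth_eq_downward:
  "rgs_from M ws \<Longrightarrow> i < length ws \<Longrightarrow> ws ! i = M + i + 1 \<Longrightarrow> j \<le> i \<Longrightarrow> ws ! j = M + j + 1"
proof (induction ws arbitrary: M i j)
  case (Cons a ws)
  show ?case
  proof (cases i)
    case (Suc i')
    with Cons.prems have ws: "rgs_from (max M a) ws" "i' < length ws" "ws ! i' = M + i' + 2"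
      by auto
    have "M + i' + 2 \<le> max M a + i' + 1"
      using rgs_from_nth_le[OF ws(1,2)] ws(3) by simp
    moreover have "a \<le> Suc M" using Cons.prems by simp
    ultimately have a: "a = Suc M" by linarith
    show ?thesis
    proof (cases j)
      case (Suc j')
      with Cons.IH[OF ws(1,2), of j'] ws(3) a \<open>i = Suc i'\<close> \<open>j \<le> i\<close> show ?thesis by simp
    qed (simp add: a)
  qed (use Cons.prems in simp)
qed simp

lemma fixed_points_ge_iff_prefix:
  assumes "rgs \<pi>"
  shows "m \<le> fixed_points \<pi> \<longleftrightarrow> (\<exists>ws. \<pi> = [1..<Suc m] @ ws)"
proof
  let ?F = "{i \<in> {1..length \<pi>}. \<pi> ! (i - 1) = i}"
  assume m: "m \<le> fixed_points \<pi>"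
  \<comment> \<open>The $m$ fixed points cannot all lie below $m$; by downward closure, one at or beyond $m$
    makes \<open>1, \<dots>, m\<close> fixed points.\<close>
  have "\<exists>i\<in>?F. m \<le> i" if "m > 0"
  proof (rule ccontr)
    assume "\<not> ?thesis"
    then have "?F \<subseteq> {1..<m}" by auto
    then have "card ?F \<le> card {1..<m}" by (intro card_mono) auto
    with m that show False by (simp add: fixed_points_def)
  qed
  then have "m = 0 \<or> (\<exists>i. m \<le> Suc i \<and> i < length \<pi> \<and> \<pi> ! i = Suc i)"
  proof (cases "m = 0")
    case False
    then obtain i where "i \<in> ?F" "m \<le> i" using \<open>m > 0 \<Longrightarrow> \<exists>i\<in>?F. m \<le> i\<close> by blast
    then have "m \<le> Suc (i - 1) \<and> i - 1 < length \<pi> \<and> \<pi> ! (i - 1) = Suc (i - 1)" by auto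
    then show ?thesis by blast
  qed simp
  then have *: "m \<le> length \<pi> \<and> (\<forall>j<m. \<pi> ! j = Suc j)"
    using rgs_from_nth_eq_downward[of 0 \<pi>] assms by (fastforce simp: rgs_iff_rgs_from)
  then have "take m \<pi> = [1..<Suc m]"
    by (intro nth_equalityI) (auto simp del: upt_Suc)
  then show "\<exists>ws. \<pi> = [1..<Suc m] @ ws"
    by (metis append_take_drop_id)
next
  assume "\<exists>ws. \<pi> = [1..<Suc m] @ ws"
  then obtain ws where \<pi>: "\<pi> = [1..<Suc m] @ ws" by blast
  have "{1..m} \<subseteq> {i \<in> {1..length \<pi>}. \<pi> ! (i - 1) = i}"
    by (auto simp: \<pi> nth_append simp del: upt_Suc)
  then have "card {1..m} \<le> fixed_points \<pi>"
    unfolding fixed_points_def by (intro card_mono) auto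
  then show "m \<le> fixed_points \<pi>" by simp
qed

lemma fold_max_upt: "fold max [1..<Suc m] 0 = m"
  by (induction m) auto

lemma rgs_from_upt: "rgs_from 0 [1..<Suc m]"
proof (induction m)
  case (Suc m)
  then show ?case
    using fold_max_upt[of m] by (auto simp: rgs_from_append)
qed simp


section \<open>Counting the continuations of a prefix\<close>

definition continuations :: "nat \<Rightarrow> nat \<Rightarrow> nat list set" where
  "continuations M r = {ws. length ws = r \<and> rgs_from M ws}"

definition continuation_poly :: "nat \<Rightarrow> nat \<Rightarrow> rat poly" where
  "continuation_poly M r = (\<Sum>ws\<in>continuations M r. monom 1 (fold max ws M))"

lemma continuations_0: "continuations M 0 = {[]}"
  by (auto simp: continuations_def)

lemma continuations_Suc:
  "continuations M (Suc r) = (\<Union>a\<in>{1..Suc M}. (#) a ` continuations (max M a) r)"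
  by (fastforce simp: continuations_def length_Suc_conv image_iff)

lemma finite_continuations: "finite (continuations M r)"
  by (induction r arbitrary: M) (auto simp: continuations_0 continuations_Suc)

lemma continuation_poly_0: "continuation_poly M 0 = monom 1 M"
  by (simp add: continuation_poly_def continuations_0)

text \<open>The first letter is one of the $M$ letters that keep the maximum, or it is the new letter
  $M+1$.\<close>

lemma continuation_poly_Suc:
  "continuation_poly M (Suc r) = of_nat M * continuation_poly M r + continuation_poly (Suc M) r"
proof -
  have "continuation_poly M (Suc r) =
      (\<Sum>a\<in>{1..Suc M}. \<Sum>ws\<in>(#) a ` continuations (max M a) r. monom 1 (fold max ws M))"
    unfolding continuation_poly_def continuations_Suc
    by (rule sum.UNION_disjoint) (auto simp: finite_continuations)
  also have "\<dots> = (\<Sum>a\<in>{1..Suc M}. continuation_poly (max M a) r)"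
    by (simp add: continuation_poly_def sum.reindex max.commute)
  also have "\<dots> = (\<Sum>a\<in>{1..M}. continuation_poly (max M a) r) + continuation_poly (Suc M) r"
    by simp
  also have "(\<Sum>a\<in>{1..M}. continuation_poly (max M a) r) = (\<Sum>a\<in>{1..M}. continuation_poly M r)"
    by (intro sum.cong) (auto simp: max_def)
  finally show ?thesis by simp
qed

lemma rgs_prefix_eq:
  assumes "m \<ge> 1"
  shows "{\<pi>. rgs \<pi> \<and> length \<pi> = n \<and> m \<le> fixed_points \<pi>} =
    (if n < m then {} else (\<lambda>ws. [1..<Suc m] @ ws) ` continuations m (n - m))"
proof -
  have "rgs ([1..<Suc m] @ ws) \<longleftrightarrow> rgs_from m ws" for ws
    using assms by (auto simp: rgs_iff_rgs_from rgs_from_append rgs_from_upt fold_max_upt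
      simp del: upt_Suc One_nat_def)
  then have "{\<pi>. rgs \<pi> \<and> length \<pi> = n \<and> m \<le> fixed_points \<pi>} =
      (\<lambda>ws. [1..<Suc m] @ ws) ` {ws. m + length ws = n \<and> rgs_from m ws}"
    using fixed_points_ge_iff_prefix[of _ m] by (auto simp del: upt_Suc)
  also have "\<dots> = (if n < m then {} else (\<lambda>ws. [1..<Suc m] @ ws) ` continuations m (n - m))"
    by (auto simp: continuations_def simp del: upt_Suc)
  finally show ?thesis .
qed

lemma sum_rgs_prefix:
  assumes "m \<ge> 1"
  shows "(\<Sum>\<pi> | rgs \<pi> \<and> length \<pi> = n \<and> m \<le> fixed_points \<pi>. monom (1::rat) (Max (set \<pi>))) =
    (if n < m then 0 else continuation_poly m (n - m))"
proof -
  have "Max (set ([1..<Suc m] @ ws)) = fold max ws m" for ws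
  proof -
    have "Max (set ([1..<Suc m] @ ws)) = fold max ([1..<Suc m] @ ws) 0"
      using assms by (intro fold_max_0_eq_Max[symmetric]) auto
    also have "\<dots> = fold max ws m" by (simp add: fold_max_upt del: upt_Suc One_nat_def)
    finally show ?thesis .
  qed
  moreover have "inj_on (\<lambda>ws. [1..<Suc m] @ ws) A" for A by (auto intro: inj_onI)
  ultimately show ?thesis
    unfolding rgs_prefix_eq[OF assms]
    by (simp add: sum.reindex continuation_poly_def del: upt_Suc)
qed

lemma smult_sum_right: "smult c (\<Sum>i\<in>A. f i) = (\<Sum>i\<in>A. smult c (f i))"
  by (induction A rule: infinite_finite_induct) (simp_all add: smult_add_right)

text \<open>Exactly \<open>m\<close> fixed points is the difference of at least \<open>m\<close> and at least \<open>m + 1\<close>. The sum over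
  \<open>k\<close> loses no sequence because the letters are bounded by the length.\<close>

lemma R_egf_nth:
  assumes "m \<ge> 1"
  shows "R_egf m $ n = smult (1 / fact n)
    ((if n < m then 0 else continuation_poly m (n - m)) -
     (if n < m + 1 then 0 else continuation_poly (m + 1) (n - (m + 1))))"
proof -
  define A where "A j = {\<pi>. rgs \<pi> \<and> length \<pi> = n \<and> j \<le> fixed_points \<pi>}" for j
  have fin: "finite (A j)" if "j \<ge> 1" for j
    unfolding A_def rgs_prefix_eq[OF that] by (simp add: finite_continuations)
  have bound: "Max (set \<pi>) \<le> n" if "rgs \<pi>" "length \<pi> = n" for \<pi>
    using that rgs_from_nth_le[of 0 \<pi>]
    by (fastforce simp: rgs_iff_rgs_from in_set_conv_nth)
  have "R_egf m $ n = (\<Sum>k=0..n. \<Sum>\<pi> | \<pi> \<in> A m - A (m + 1) \<and> Max (set \<pi>) = k.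
      monom (1 / fact n) (Max (set \<pi>)))"
    unfolding R_egf_def fps_nth_Abs_fps
    by (intro sum.cong) (auto simp: RGS_def A_def)
  also have "\<dots> = (\<Sum>\<pi> \<in> A m - A (m + 1). monom (1 / fact n) (Max (set \<pi>)))"
    using fin[OF assms] bound by (intro sum.group) (auto simp: A_def)
  also have "\<dots> = (\<Sum>\<pi> \<in> A m. monom (1 / fact n) (Max (set \<pi>))) -
      (\<Sum>\<pi> \<in> A (m + 1). monom (1 / fact n) (Max (set \<pi>)))"
    using fin[OF assms] by (intro sum_diff) (auto simp: A_def)
  also have "\<dots> = smult (1 / fact n) ((\<Sum>\<pi> \<in> A m. monom 1 (Max (set \<pi>))) -
      (\<Sum>\<pi> \<in> A (m + 1). monom 1 (Max (set \<pi>))))"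
    by (simp add: smult_diff_right smult_sum_right smult_monom)
  finally show ?thesis
    unfolding A_def using sum_rgs_prefix[OF assms, of n] sum_rgs_prefix[of "m + 1" n] by simp
qed


section \<open>Exponentials of series in one variable\<close>

text \<open>The composition $e^F$ for \<open>F\<close> without constant term. Then $F^k$ has no terms below degree $k$,
  so the exponential series may be cut off anywhere beyond the index of the coefficient. The
  cut-off at $n$ matches the one of \<open>biexp\<close> at total degree $i + j$.\<close>

definition exp_comp :: "rat poly fps \<Rightarrow> rat poly fps" where
  "exp_comp F = Abs_fps (\<lambda>n. \<Sum>k\<le>n. smult (1 / fact k) ((F ^ k) $ n))"

lemma exp_comp_nth:
  assumes "F $ 0 = 0" "n \<le> N"
  shows "exp_comp F $ n = (\<Sum>k\<le>N. smult (1 / fact k) ((F ^ k) $ n))"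
  unfolding exp_comp_def fps_nth_Abs_fps
  by (rule sum.mono_neutral_left)
     (use assms in \<open>auto intro!: startsby_zero_power_prefix[rule_format]\<close>)

lemma exp_comp_nth_0: "exp_comp F $ 0 = 1"
  by (simp add: exp_comp_def)

lemma fps_deriv_exp_comp:
  assumes "F $ 0 = 0"
  shows "fps_deriv (exp_comp F) = fps_deriv F * exp_comp F"
proof (rule fps_ext)
  fix n
  have "fps_deriv (exp_comp F) $ n =
      of_nat (n + 1) * (\<Sum>k\<le>Suc n. smult (1 / fact k) ((F ^ k) $ Suc n))"
    using exp_comp_nth[OF assms, of "Suc n" "Suc n"] by simp
  also have "\<dots> = (\<Sum>k\<le>Suc n. smult (1 / fact k) (fps_deriv (F ^ k) $ n))"
    by (simp add: sum_distrib_left del: sum.atMost_Suc power_Suc of_nat_Suc fact_Suc)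
  also have "\<dots> = (\<Sum>k\<le>n. smult (1 / fact (Suc k)) (fps_deriv (F ^ Suc k) $ n))"
    by (subst sum.atMost_Suc_shift) simp
  also have "\<dots> = (\<Sum>k\<le>n. smult (1 / fact k) ((fps_deriv F * F ^ k) $ n))"
  proof (rule sum.cong)
    fix k
    have "fps_deriv (F ^ Suc k) = of_nat (Suc k) * (fps_deriv F * F ^ k)"
      by (simp add: fps_deriv_power' mult_ac del: power_Suc)
    then have "fps_deriv (F ^ Suc k) $ n = smult (of_nat (Suc k)) ((fps_deriv F * F ^ k) $ n)"
      by (simp add: fps_of_nat[symmetric] of_nat_poly del: of_nat_Suc)
    then show "smult (1 / fact (Suc k)) (fps_deriv (F ^ Suc k) $ n) =
        smult (1 / fact k) ((fps_deriv F * F ^ k) $ n)"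
      by (simp add: fact_Suc del: of_nat_Suc)
  qed simp
  also have "\<dots> = (\<Sum>k\<le>n. \<Sum>i=0..n. fps_deriv F $ i * smult (1 / fact k) ((F ^ k) $ (n - i)))"
    by (simp add: fps_mult_nth smult_sum_right)
  also have "\<dots> = (\<Sum>i=0..n. fps_deriv F $ i * (\<Sum>k\<le>n. smult (1 / fact k) ((F ^ k) $ (n - i))))"
    by (subst sum.swap) (simp add: sum_distrib_left)
  also have "\<dots> = (fps_deriv F * exp_comp F) $ n"
    unfolding fps_mult_nth by (intro sum.cong) (simp_all add: exp_comp_nth[OF assms, of _ n])
  finally show "fps_deriv (exp_comp F) $ n = (fps_deriv F * exp_comp F) $ n" .
qed

text \<open>The equation $F' = gF$ expresses $(n+1) F_{n+1}$ by earlier coefficients, so it determines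
  \<open>F\<close> from its constant term.\<close>

lemma fps_linear_ode_unique:
  fixes F G :: "'a :: {idom, ring_char_0} fps"
  assumes "fps_deriv F = g * F" "fps_deriv G = g * G" "F $ 0 = G $ 0"
  shows "F = G"
proof (rule fps_ext)
  fix n show "F $ n = G $ n"
  proof (induction n rule: less_induct)
    case (less n)
    show ?case
    proof (cases n)
      case (Suc n')
      have "fps_deriv F $ n' = fps_deriv G $ n'"
        unfolding assms(1,2) fps_mult_nth using Suc by (intro sum.cong) (auto intro: less.IH)
      then show ?thesis using Suc by (simp del: of_nat_Suc)
    qed (use assms(3) in simp)
  qed
qed

text \<open>Both sides satisfy the same first-order linear equation.\<close>

lemma exp_comp_add:
  assumes "F $ 0 = 0" "G $ 0 = 0"
  shows "exp_comp (F + G) = exp_comp F * exp_comp G"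
  by (rule fps_linear_ode_unique[where g = "fps_deriv F + fps_deriv G"])
     (use assms in \<open>simp_all add: fps_deriv_exp_comp exp_comp_nth_0 algebra_simps\<close>)

text \<open>The exponent $y(e^z-1)+mz$. For \<open>m = 0\<close>, its exponential is the generating function of the
  Touchard (Bell) polynomials.\<close>

definition bell_exponent :: "nat \<Rightarrow> rat poly fps" where
  "bell_exponent m = fps_const [:0, 1:] * (exp_comp fps_X - 1) + of_nat m * fps_X"

lemma bell_exponent_nth_0: "bell_exponent m $ 0 = 0"
  by (simp add: bell_exponent_def exp_comp_nth_0)

text \<open>The derivative of the exponent is $m + y e^z$, and the factor $e^z$ raises $m$ to $m+1$.
  After multiplication by $y^m$ this is the recurrence of the continuation polynomials.\<close>

lemma fps_deriv_exp_bell_exponent: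
  "fps_deriv (exp_comp (bell_exponent m)) =
    of_nat m * exp_comp (bell_exponent m) + fps_const [:0, 1:] * exp_comp (bell_exponent (Suc m))"
proof -
  have "bell_exponent (Suc m) = fps_X + bell_exponent m"
    by (simp add: bell_exponent_def algebra_simps)
  then have "exp_comp (bell_exponent (Suc m)) = exp_comp fps_X * exp_comp (bell_exponent m)"
    by (simp add: exp_comp_add bell_exponent_nth_0)
  moreover have "fps_deriv (bell_exponent m) = fps_const [:0, 1:] * exp_comp fps_X + of_nat m"
    by (simp add: bell_exponent_def fps_deriv_exp_comp)
  ultimately show ?thesis
    by (simp add: fps_deriv_exp_comp bell_exponent_nth_0 algebra_simps)
qed

lemma exp_bell_exponent_nth:
  "monom 1 m * exp_comp (bell_exponent m) $ r = smult (1 / fact r) (continuation_poly m r)"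
proof (induction r arbitrary: m)
  case 0
  then show ?case by (simp add: exp_comp_nth_0 continuation_poly_0)
next
  case (Suc r)
  let ?H = "\<lambda>m. exp_comp (bell_exponent m)"
  have y: "monom 1 m * [:0, 1:] = (monom 1 (Suc m) :: rat poly)"
    by (simp add: monom_Suc)
  have "of_nat (Suc r) * (monom 1 m * ?H m $ Suc r) = monom 1 m * fps_deriv (?H m) $ r"
    by (simp add: mult_ac del: of_nat_Suc)
  also have "\<dots> = of_nat m * (monom 1 m * ?H m $ r) + (monom 1 m * [:0, 1:]) * ?H (Suc m) $ r"
    by (simp only: fps_deriv_exp_bell_exponent fps_add_nth fps_mult_left_const_nth
      fps_of_nat[symmetric] distrib_left mult.assoc mult.left_commute)
  also have "\<dots> = smult (1 / fact r) (continuation_poly m (Suc r))"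
    unfolding y Suc.IH continuation_poly_Suc by (simp add: smult_add_right)
  also have "\<dots> = of_nat (Suc r) * smult (1 / fact (Suc r)) (continuation_poly m (Suc r))"
    by (simp add: of_nat_poly fact_Suc del: of_nat_Suc)
  finally show ?case by (simp only: mult_cancel_left of_nat_eq_0_iff nat.distinct simp_thms)
qed


section \<open>Substituting x - t\<close>

text \<open>The series $F(x-t)$: by the binomial theorem, $(x-t)^{i+j}$ contributes
  $(-1)^i \binom{i+j}{i}$ to the coefficient of $x^j t^i$.\<close>

definition subst_x_minus_t :: "rat poly fps \<Rightarrow> bifps" where
  "subst_x_minus_t F =
     Abs_fps (\<lambda>i. Abs_fps (\<lambda>j. (-1) ^ i * of_nat ((i + j) choose i) * F $ (i + j)))"

lemma subst_x_minus_t_nth: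
  "subst_x_minus_t F $ i $ j = (-1) ^ i * of_nat ((i + j) choose i) * F $ (i + j)"
  by (simp add: subst_x_minus_t_def)

lemma subst_x_minus_t_add: "subst_x_minus_t (F + G) = subst_x_minus_t F + subst_x_minus_t G"
  by (intro fps_ext) (simp add: subst_x_minus_t_nth algebra_simps)

lemma subst_x_minus_t_diff: "subst_x_minus_t (F - G) = subst_x_minus_t F - subst_x_minus_t G"
  by (intro fps_ext) (simp add: subst_x_minus_t_nth algebra_simps)

lemma subst_x_minus_t_const: "subst_x_minus_t (fps_const c) = fps_const (fps_const c)"
  by (intro fps_ext) (simp add: subst_x_minus_t_nth)

lemma subst_x_minus_t_X: "subst_x_minus_t fps_X = var_x - var_t"
proof (intro fps_ext)
  fix i j :: nat
  consider "i = 0" | "i = 1" "j = 0" | "i = 1" "j > 0" | "i > 1" by linarith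
  then show "subst_x_minus_t fps_X $ i $ j = (var_x - var_t) $ i $ j"
    by cases (auto simp: subst_x_minus_t_nth var_x_def var_t_def fps_X_def)
qed

text \<open>Multiplicativity is Vandermonde's identity
  $\sum_a \binom{s}{a}\binom{N-s}{i-a} = \binom{N}{i}$, where $N = i+j$ and $s$ is the degree taken
  from \<open>F\<close>.\<close>

lemma subst_x_minus_t_mult: "subst_x_minus_t (F * G) = subst_x_minus_t F * subst_x_minus_t G"
proof (intro fps_ext)
  fix i j
  define h where "h a s = (-1) ^ i * of_nat (s choose a) *
    of_nat ((i + j - s) choose (i - a)) * (F $ s * G $ (i + j - s))" for a s
  have "(subst_x_minus_t F * subst_x_minus_t G) $ i $ j = (\<Sum>a\<le>i. \<Sum>b\<le>j. h a (a + b))"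
  proof -
    have "((-1) ^ a * of_nat ((a + b) choose a) * F $ (a + b)) *
        ((-1) ^ (i - a) * of_nat ((i - a + (j - b)) choose (i - a)) * G $ (i - a + (j - b))) =
        h a (a + b)" if "a \<le> i" "b \<le> j" for a b
    proof -
      have "i - a + (j - b) = i + j - (a + b)" using that by simp
      moreover have "(-1 :: rat poly) ^ a * (-1) ^ (i - a) = (-1) ^ i"
        using that by (simp flip: power_add)
      ultimately show ?thesis by (simp add: h_def mult_ac)
    qed
    then show ?thesis
      by (simp add: fps_mult_nth fps_sum_nth subst_x_minus_t_nth atLeast0AtMost)
  qed
  \<comment> \<open>Summing over $s = a + b$ instead of $b$ adds only terms in which one of the two binomial
    coefficients vanishes.\<close>
  also have "\<dots> = (\<Sum>a\<le>i. \<Sum>s\<le>i+j. h a s)"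
  proof (rule sum.cong)
    fix a assume "a \<in> {..i}"
    then have a: "a \<le> i" by simp
    have "(\<Sum>b\<le>j. h a (a + b)) = (\<Sum>s\<in>(+) a ` {..j}. h a s)"
      by (simp add: sum.reindex)
    also have "\<dots> = (\<Sum>s\<le>i+j. h a s)"
    proof (rule sum.mono_neutral_left)
      show "\<forall>s\<in>{..i + j} - (+) a ` {..j}. h a s = 0"
      proof
        fix s assume s: "s \<in> {..i + j} - (+) a ` {..j}"
        have "s < a \<or> s > a + j"
        proof (rule ccontr)
          assume "\<not> ?thesis"
          then have "s = a + (s - a)" "s - a \<le> j" by auto
          with s show False by blast
        qed
        with s a show "h a s = 0" by (auto simp: h_def binomial_eq_0)
      qed
    qed (use a in auto)
    finally show "(\<Sum>b\<le>j. h a (a + b)) = (\<Sum>s\<le>i+j. h a s)" .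
  qed simp
  also have "\<dots> = (\<Sum>s\<le>i+j. (-1) ^ i *
      of_nat (\<Sum>a\<le>i. (s choose a) * ((i + j - s) choose (i - a))) * (F $ s * G $ (i + j - s)))"
    by (subst sum.swap) (simp add: h_def sum_distrib_left sum_distrib_right mult_ac)
  also have "\<dots> = (\<Sum>s\<le>i+j. (-1) ^ i * of_nat ((i + j) choose i) * (F $ s * G $ (i + j - s)))"
    by (intro sum.cong) (simp_all add: vandermonde del: of_nat_sum)
  also have "\<dots> = subst_x_minus_t (F * G) $ i $ j"
    by (simp add: subst_x_minus_t_nth fps_mult_nth atLeast0AtMost sum_distrib_left)
  finally show "subst_x_minus_t (F * G) $ i $ j = (subst_x_minus_t F * subst_x_minus_t G) $ i $ j"
    by simp
qed

lemma subst_x_minus_t_1: "subst_x_minus_t 1 = 1"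
  using subst_x_minus_t_const[of 1] by simp

lemma subst_x_minus_t_of_nat: "subst_x_minus_t (of_nat m) = of_nat m"
  by (induction m) (simp_all add: subst_x_minus_t_add subst_x_minus_t_1
    subst_x_minus_t_const[of 0, simplified])

lemma subst_x_minus_t_power: "subst_x_minus_t (F ^ n) = subst_x_minus_t F ^ n"
  by (induction n) (simp_all add: subst_x_minus_t_mult subst_x_minus_t_1)

text \<open>The coefficient of $x^j t^i$ in $F(x-t)^n$ is a multiple of the coefficient of $z^{i+j}$ in
  $F^n$, and both exponentials cut off their sums at $n = i + j$.\<close>

lemma biexp_subst_x_minus_t: "biexp (subst_x_minus_t F) = subst_x_minus_t (exp_comp F)"
  by (intro fps_ext)
     (simp add: biexp_def exp_comp_def subst_x_minus_t_nth subst_x_minus_t_power[symmetric]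
       sum_distrib_left)

lemma biexp_bell_exponent:
  "biexp (var_y * (biexp (var_x - var_t) - 1) + of_nat m * (var_x - var_t)) =
    subst_x_minus_t (exp_comp (bell_exponent m))"
proof -
  have "var_y * (biexp (var_x - var_t) - 1) + of_nat m * (var_x - var_t) =
      subst_x_minus_t (bell_exponent m)"
    by (simp add: bell_exponent_def subst_x_minus_t_add subst_x_minus_t_diff subst_x_minus_t_mult
      subst_x_minus_t_const subst_x_minus_t_1 subst_x_minus_t_of_nat var_y_def
      subst_x_minus_t_X[symmetric] biexp_subst_x_minus_t)
  then show ?thesis by (simp add: biexp_subst_x_minus_t)
qed


section \<open>The Beta integral\<close>

text \<open>This is $\int_0^1 t^k (1-t)^r\,dt = B(k+1, r+1)$ with $(1-t)^r$ expanded. The induction on $r$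
  splits $(1-t)^{r+1}$ as $(1-t)^r - t(1-t)^r$, which is Pascal's rule for the sums.\<close>

lemma alternating_binomial_sum_beta:
  "(\<Sum>a\<le>r. (-1) ^ a * of_nat (r choose a) / of_nat (Suc k + a)) =
    (fact k * fact r / fact (Suc k + r) :: 'a :: field_char_0)"
proof (induction r arbitrary: k)
  case 0
  then show ?case by (simp add: fact_Suc del: of_nat_Suc)
next
  case (Suc r)
  let ?f = "\<lambda>r k a. (-1) ^ a * of_nat (r choose a) / of_nat (Suc k + a) :: 'a"
  have pascal: "?f (Suc r) k (Suc a) = ?f r k (Suc a) - ?f r (Suc k) a" for a
    by (simp add: add_divide_distrib diff_divide_distrib algebra_simps)
  have "(\<Sum>a\<le>Suc r. ?f (Suc r) k a) = ?f r k 0 + (\<Sum>a\<le>r. ?f r k (Suc a) - ?f r (Suc k) a)"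
    by (subst sum.atMost_Suc_shift) (simp only: pascal, simp)
  also have "\<dots> = (\<Sum>a\<le>Suc r. ?f r k a) - (\<Sum>a\<le>r. ?f r (Suc k) a)"
    by (subst sum.atMost_Suc_shift) (simp add: sum_subtractf del: binomial_Suc_Suc)
  also have "(\<Sum>a\<le>Suc r. ?f r k a) = (\<Sum>a\<le>r. ?f r k a)"
    by simp
  also have "(\<Sum>a\<le>r. ?f r k a) - (\<Sum>a\<le>r. ?f r (Suc k) a) =
      fact k * fact r / fact (Suc k + r) - fact (Suc k) * fact r / fact (Suc (Suc k) + r)"
    by (simp only: Suc.IH)
  also have "\<dots> = fact k * fact (Suc r) / fact (Suc k + Suc r)"
  proof -
    define D c :: 'a where "D = fact (Suc k + r)" and "c = of_nat (Suc (Suc k) + r)"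
    have fact_c: "fact (Suc (Suc k) + r) = c * D"
      by (simp add: D_def c_def)
    have nz: "D \<noteq> 0" "c \<noteq> 0" by (simp_all add: D_def c_def del: of_nat_Suc)
    have "fact k * fact r / D - fact (Suc k) * fact r / (c * D) =
        fact k * fact r * (c - of_nat (Suc k)) / (c * D)"
      using nz by (simp add: fact_Suc field_simps del: of_nat_Suc)
    also have "c - of_nat (Suc k) = of_nat (Suc r)"
      by (simp add: c_def)
    finally show ?thesis
      using fact_c by (simp add: D_def mult_ac del: of_nat_Suc)
  qed
  finally show ?case .
qed

text \<open>The integral of $t^k (x-t)^r$ over $[0,x]$ is $\frac{k!\,r!}{(k+r+1)!}\,x^{k+r+1}$, applied to each
  term of \<open>H\<close>.\<close>

lemma integral_0_x_subst_x_minus_t_nth: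
  "integral_0_x (var_y ^ m * var_t ^ k * subst_x_minus_t H) $ n =
    (if n < Suc k then 0
     else smult (fact k * fact (n - Suc k) / fact n) (monom 1 m * H $ (n - Suc k)))"
proof -
  let ?F = "var_y ^ m * var_t ^ k * subst_x_minus_t H"
  have F_nth: "?F $ i $ j =
      (if i < k then 0 else monom 1 m * subst_x_minus_t H $ (i - k) $ j)" for i j
  proof -
    have y: "[:0, 1:] ^ m = (monom 1 m :: rat poly)"
      by (simp add: monom_altdef)
    have F_eq: "?F = fps_X ^ k * (fps_const (fps_const (monom 1 m)) * subst_x_minus_t H)"
      unfolding var_y_def var_t_def fps_const_power y by (simp only: mult_ac)
    show ?thesis unfolding F_eq fps_X_power_mult_nth by simp
  qed
  have "integral_0_x ?F $ n = (\<Sum>i\<le>n. antideriv_t ?F $ i $ (n - i))"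
    by (simp add: integral_0_x_def subst_t_x_def)
  also have "\<dots> = (\<Sum>i | i \<le> n \<and> k < i. smult (1 / of_nat i)
      (monom 1 m * subst_x_minus_t H $ (i - Suc k) $ (n - i)))"
    by (rule sum.mono_neutral_cong_right) (auto simp: antideriv_t_def F_nth)
  also have "\<dots> = (if n < Suc k then 0
     else smult (fact k * fact (n - Suc k) / fact n) (monom 1 m * H $ (n - Suc k)))"
  proof (cases "n < Suc k")
    case True
    then have "{i. i \<le> n \<and> k < i} = {}" by auto
    with True show ?thesis by (simp only: sum.empty if_True)
  next
    case False
    \<comment> \<open>Only $z^r$ in \<open>H\<close> contributes to $x^n$. The exponent of $t$ after integration is
      $i = k + 1 + a$, where $t^a$ comes from $(x-t)^r$.\<close>
    define r where "r = n - Suc k"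
    have n: "n = Suc k + r" using False by (simp add: r_def)
    have scalar: "(-1 :: rat poly) ^ a * of_nat c = [:(-1) ^ a * of_nat c:]" for a c
      by (induction a) (simp_all add: of_nat_poly)
    have pull_out: "p * ((-1) ^ a * of_nat c * q) = smult ((-1) ^ a * of_nat c) (p * q)"
      for p q :: "rat poly" and a c
      unfolding scalar by simp
    have "(\<Sum>i | i \<le> n \<and> k < i. smult (1 / of_nat i)
        (monom 1 m * subst_x_minus_t H $ (i - Suc k) $ (n - i))) =
      (\<Sum>a\<le>r. smult (1 / of_nat (Suc k + a)) (monom 1 m * subst_x_minus_t H $ a $ (r - a)))"
      by (rule sum.reindex_bij_witness[of _ "\<lambda>a. Suc k + a" "\<lambda>i. i - Suc k"])
         (auto simp: n add_ac)
    also have "\<dots> = (\<Sum>a\<le>r. smult ((-1) ^ a * of_nat (r choose a) / of_nat (Suc k + a))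
        (monom 1 m * H $ r))"
      by (intro sum.cong) (simp_all add: subst_x_minus_t_nth pull_out del: of_nat_Suc)
    also have "\<dots> = smult (fact k * fact r / fact (Suc k + r)) (monom 1 m * H $ r)"
      by (simp only: smult_sum[symmetric] alternating_binomial_sum_beta)
    finally show ?thesis using n by simp
  qed
  finally show ?thesis .
qed

text \<open>Each of the two terms of the theorem is the exponential generating function of the sequences
  with at least $k+1$ fixed points; compare \<open>R_egf_nth\<close>.\<close>

lemma integral_term_nth:
  "(fps_const [:1 / fact k:] *
     integral_0_x (var_y ^ Suc k * var_t ^ k *
       biexp (var_y * (biexp (var_x - var_t) - 1) + of_nat (Suc k) * (var_x - var_t)))) $ n =
   (if n < Suc k then 0 else smult (1 / fact n) (continuation_poly (Suc k) (n - Suc k)))"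
  unfolding biexp_bell_exponent fps_mult_left_const_nth integral_0_x_subst_x_minus_t_nth
  by (simp add: exp_bell_exponent_nth del: power_Suc)

section \<open>The generating function for sequences with m fixed points\<close>

theorem corollary2:
  fixes m :: nat
  assumes "m \<ge> 1"
  shows "R_egf m =
      fps_const [:1 / fact (m - 1):] *
        integral_0_x (var_y ^ m * var_t ^ (m - 1) *
          biexp (var_y * (biexp (var_x - var_t) - 1) + of_nat m * (var_x - var_t)))
    - fps_const [:1 / fact m:] *
        integral_0_x (var_y ^ (m + 1) * var_t ^ m *
          biexp (var_y * (biexp (var_x - var_t) - 1) + of_nat (m + 1) * (var_x - var_t)))"
proof (rule fps_ext)
  fix n
  have m: "Suc (m - 1) = m" using assms by simp
  show "R_egf m $ n = (fps_const [:1 / fact (m - 1):] *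
        integral_0_x (var_y ^ m * var_t ^ (m - 1) *
          biexp (var_y * (biexp (var_x - var_t) - 1) + of_nat m * (var_x - var_t)))
    - fps_const [:1 / fact m:] *
        integral_0_x (var_y ^ (m + 1) * var_t ^ m *
          biexp (var_y * (biexp (var_x - var_t) - 1) + of_nat (m + 1) * (var_x - var_t)))) $ n"
    unfolding fps_sub_nth integral_term_nth[of "m - 1" n, unfolded m]
      integral_term_nth[of m n, folded Suc_eq_plus1] Suc_eq_plus1[symmetric]
      R_egf_nth[OF assms]
    by (simp add: smult_diff_right)
qed

end
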